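(* Let $n=1$ or let $n$ be a prime with $n\equiv 1\pmod{10}$, and let $d=17n-1$. Then there exists a Cayley graph of diameter two, degree $d$, and order $\frac{200}{289}(d+1)^2$ (i.e. with $200n^2$ vertices).
   Context: For a finite group $\Gamma$ and a generating set $X\subset\Gamma$ with $1_\Gamma\notin X$ and $X=X^{-1}$, the Cayley graph $\mathrm{Cay}(\Gamma,X)$ has vertex set $\Gamma$ and edges $\{g,h\}$ whenever $g^{-1}h\in X$; it is a simple undirected $|X|$-regular graph, and its degree is $|X|$. *)

theory Defs
  imports "HOL-Algebra.Algebra"
begin

definition is_walk :: "'a set \<Rightarrow> ('a \<Rightarrow> 'a \<Rightarrow> bool) \<Rightarrow> 'a list \<Rightarrow> 'a \<Rightarrow> 'a \<Rightarrow> bool" where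
  "is_walk V E p u v \<longleftrightarrow> p \<noteq> [] \<and> set p \<subseteq> V \<and> hd p = u \<and> last p = v \<and>
     (\<forall>i. Suc i < length p \<longrightarrow> E (p ! i) (p ! Suc i))"

definition graph_dist :: "'a set \<Rightarrow> ('a \<Rightarrow> 'a \<Rightarrow> bool) \<Rightarrow> 'a \<Rightarrow> 'a \<Rightarrow> nat" where
  "graph_dist V E u v = (LEAST k. \<exists>p. is_walk V E p u v \<and> length p = Suc k)"

definition connected_graph :: "'a set \<Rightarrow> ('a \<Rightarrow> 'a \<Rightarrow> bool) \<Rightarrow> bool" where
  "connected_graph V E \<longleftrightarrow> (\<forall>u\<in>V. \<forall>v\<in>V. \<exists>p. is_walk V E p u v)"

definition graph_diameter :: "'a set \<Rightarrow> ('a \<Rightarrow> 'a \<Rightarrow> bool) \<Rightarrow> nat" where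
  "graph_diameter V E = Max {graph_dist V E u v | u v. u \<in> V \<and> v \<in> V}"

definition cayley_adj :: "('a, 'b) monoid_scheme \<Rightarrow> 'a set \<Rightarrow> 'a \<Rightarrow> 'a \<Rightarrow> bool" where
  "cayley_adj G S g h \<longleftrightarrow> g \<in> carrier G \<and> h \<in> carrier G \<and> inv\<^bsub>G\<^esub> g \<otimes>\<^bsub>G\<^esub> h \<in> S"

definition cayley_set :: "('a, 'b) monoid_scheme \<Rightarrow> 'a set \<Rightarrow> bool" where
  "cayley_set G S \<longleftrightarrow> S \<subseteq> carrier G \<and> \<one>\<^bsub>G\<^esub> \<notin> S \<and>
     (\<forall>x\<in>S. inv\<^bsub>G\<^esub> x \<in> S) \<and> generate G S = carrier G"

end

theory Submission
  imports Defs "HOL-Number_Theory.Number_Theory" "HOL-Library.Countable"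
begin

text \<open>
  Let \<open>z\<close> have order 10 modulo \<open>n\<close> (or \<open>z = 1\<close> if \<open>n = 1\<close>), and let the \<open>i\<close>-th element of the
  cyclic group of order 10 act on the integers modulo \<open>n\<close> as multiplication by \<open>z\<^sup>2\<^sup>i\<close>. The group
  is the wreath product of the resulting affine group with a group of order two: an extension
  of the plane over \<open>\<int>/n\<close> by a base group of order 200. Over each of 16 elements of the base group
  the connection set contains a line through the origin whose slope is a power of \<open>z\<close>; one of
  the 16, an involution, carries two such lines, which share the origin. This gives \<open>17n - 1\<close>
  elements. The products of two such lines fill a whole fibre as soon as the first line and the
  translate of the second one have different slopes. So it suffices that every element of the
  base group is a product of two of the 16 elements with transversal lines, a finite condition
  on exponents modulo 10. The identity of the base group is reached through the two lines over
  the involution.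
\<close>

section \<open>Diameter two from products of two generators\<close>

text \<open>If u^-1 v = s t with s, t in \<open>S\<close>, then u, u s, v is a walk with two edges,
  which bounds every distance by 2. The cardinality bound leaves a vertex that is neither the
  identity nor adjacent to it, so distance 2 is attained.\<close>

lemma (in group) cayley_diameter_two:
  assumes fin: "finite (carrier G)" and S: "S \<subseteq> carrier G" "\<one> \<notin> S"
    and inv_closed: "\<And>x. x \<in> S \<Longrightarrow> \<exists>y\<in>S. x \<otimes> y = \<one>"
    and prods: "\<And>g. g \<in> carrier G \<Longrightarrow> \<exists>s\<in>S. \<exists>t\<in>S. g = s \<otimes> t"
    and card: "card S + 1 < card (carrier G)"
  shows "cayley_set G S" "connected_graph (carrier G) (cayley_adj G S)"
    "graph_diameter (carrier G) (cayley_adj G S) = 2"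
proof -
  let ?V = "carrier G" and ?E = "cayley_adj G S"
  let ?d = "graph_dist ?V ?E"
  have "inv x \<in> S" if x: "x \<in> S" for x
  proof -
    obtain y where y: "y \<in> S" "x \<otimes> y = \<one>" using inv_closed[OF x] by blast
    then have "inv y = x" using S x by (intro inv_equality) auto
    then show ?thesis using y S by auto
  qed
  moreover have "generate G S = ?V"
  proof
    show "generate G S \<subseteq> ?V" by (rule generate_incl[OF S(1)])
    show "?V \<subseteq> generate G S"
    proof
      fix g assume "g \<in> ?V"
      then obtain s t where "s \<in> S" "t \<in> S" "g = s \<otimes> t" using prods by blast
      then show "g \<in> generate G S" by (auto intro: generate.intros)
    qed
  qed
  ultimately show "cayley_set G S" using S by (simp add: cayley_set_def)
  have walk: "\<exists>p. is_walk ?V ?E p u v \<and> length p = Suc 2" if uv: "u \<in> ?V" "v \<in> ?V" for u v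
  proof -
    obtain s t where st: "s \<in> S" "t \<in> S" "inv u \<otimes> v = s \<otimes> t"
      using prods[of "inv u \<otimes> v"] uv by auto
    have c: "s \<in> ?V" "t \<in> ?V" using st S by auto
    have "v = u \<otimes> (s \<otimes> t)" using uv c by (simp add: st(3)[symmetric] m_assoc[symmetric])
    then have v: "v = (u \<otimes> s) \<otimes> t" using uv c by (simp add: m_assoc)
    have "inv x \<otimes> (x \<otimes> y) = y" if "x \<in> ?V" "y \<in> ?V" for x y
      using that by (simp add: m_assoc[symmetric])
    then have "inv u \<otimes> (u \<otimes> s) = s" "inv (u \<otimes> s) \<otimes> v = t"
      unfolding v using uv(1) c by simp_all
    then have "?E u (u \<otimes> s)" "?E (u \<otimes> s) v"
      using uv c st by (simp_all add: cayley_adj_def)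
    then have "is_walk ?V ?E [u, u \<otimes> s, v] u v"
      using uv c by (auto simp: is_walk_def nth_Cons split: nat.split)
    then show ?thesis by (intro exI[of _ "[u, u \<otimes> s, v]"]) simp
  qed
  then show "connected_graph ?V ?E" unfolding connected_graph_def by blast
  have le: "?d u v \<le> 2" if "u \<in> ?V" "v \<in> ?V" for u v
    unfolding graph_dist_def by (rule Least_le) (rule walk[OF that])
  have "\<not> ?V \<subseteq> insert \<one> S"
  proof
    assume "?V \<subseteq> insert \<one> S"
    then have "card ?V \<le> card (insert \<one> S)"
      using fin S by (intro card_mono) (auto intro: finite_subset)
    also have "\<dots> \<le> card S + 1" by (simp add: card_insert_le_m1 card_insert_if)
    finally show False using card by simp
  qed
  then obtain v where v: "v \<in> ?V" "v \<noteq> \<one>" "v \<notin> S" by blast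
  have "\<exists>p. is_walk ?V ?E p \<one> v \<and> length p = Suc (?d \<one> v)"
    unfolding graph_dist_def by (rule LeastI) (rule walk[OF one_closed v(1)])
  then obtain p where p: "is_walk ?V ?E p \<one> v" "length p = Suc (?d \<one> v)" by blast
  have "?d \<one> v \<noteq> 0"
  proof
    assume "?d \<one> v = 0"
    then obtain x where "p = [x]" using p(2) by (metis length_Suc_conv length_0_conv)
    then show False using p(1) v(2) by (auto simp: is_walk_def)
  qed
  moreover have "?d \<one> v \<noteq> 1"
  proof
    assume "?d \<one> v = 1"
    then obtain x y where "p = [x, y]" using p(2) by (metis length_Suc_conv length_0_conv One_nat_def)
    then show False using p(1) v by (auto simp: is_walk_def cayley_adj_def)
  qed
  ultimately have d2: "?d \<one> v = 2" using le[OF one_closed v(1)] by simp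
  have "{?d u v | u v. u \<in> ?V \<and> v \<in> ?V} = (\<lambda>(u, v). ?d u v) ` (?V \<times> ?V)" by auto
  moreover have "Max ((\<lambda>(u, v). ?d u v) ` (?V \<times> ?V)) = 2"
  proof (rule Max_eqI)
    show "finite ((\<lambda>(u, v). ?d u v) ` (?V \<times> ?V))" using fin by blast
    show "y \<le> 2" if "y \<in> (\<lambda>(u, v). ?d u v) ` (?V \<times> ?V)" for y using that le by auto
    show "2 \<in> (\<lambda>(u, v). ?d u v) ` (?V \<times> ?V)"
      using d2 v(1) by (force intro!: image_eqI[of _ _ "(\<one>, v)"])
  qed
  ultimately show "graph_diameter ?V ?E = 2" unfolding graph_diameter_def by simp
qed

section \<open>Affine groups and wreath products\<close>

text \<open>A pair (x, i) stands for the affine map y -> x + w^i y, but the exponent i itself is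
  kept. The order is therefore n m even if w has smaller order than m; this happens below, where w =
  z^2 and m = 10.\<close>

definition affine_group :: "int \<Rightarrow> int \<Rightarrow> nat \<Rightarrow> (int \<times> nat) monoid" where
  "affine_group n w m = \<lparr>carrier = {0..<n} \<times> {0..<m},
     monoid.mult = (\<lambda>(x, i) (y, j). ((x + w ^ i * y) mod n, (i + j) mod m)), one = (0, 0)\<rparr>"

definition wreath_two :: "('a, 'b) monoid_scheme \<Rightarrow> ('a \<times> 'a \<times> bool) monoid" where
  "wreath_two K = \<lparr>carrier = carrier K \<times> carrier K \<times> UNIV,
     monoid.mult = (\<lambda>(a, b, e) (c, d, f).
       (a \<otimes>\<^bsub>K\<^esub> (if e then d else c), b \<otimes>\<^bsub>K\<^esub> (if e then c else d), e \<noteq> f)),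
     one = (\<one>\<^bsub>K\<^esub>, \<one>\<^bsub>K\<^esub>, False)\<rparr>"

lemma group_wreath_two:
  assumes "group K"
  shows "group (wreath_two K)"
proof -
  interpret K: group K by fact
  show ?thesis
  proof (rule groupI)
    fix x assume "x \<in> carrier (wreath_two K)"
    then obtain a b e where x: "x = (a, b, e)" "a \<in> carrier K" "b \<in> carrier K"
      by (auto simp: wreath_two_def)
    \<comment> \<open>A set flag exchanges the components of the right factor, so the inverses must
      be exchanged as well.\<close>
    let ?y = "if e then (inv\<^bsub>K\<^esub> b, inv\<^bsub>K\<^esub> a, e) else (inv\<^bsub>K\<^esub> a, inv\<^bsub>K\<^esub> b, e)"
    have "?y \<in> carrier (wreath_two K)" "?y \<otimes>\<^bsub>wreath_two K\<^esub> x = \<one>\<^bsub>wreath_two K\<^esub>"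
      using x by (auto simp: wreath_two_def)
    then show "\<exists>y\<in>carrier (wreath_two K). y \<otimes>\<^bsub>wreath_two K\<^esub> x = \<one>\<^bsub>wreath_two K\<^esub>" by blast
  qed (auto simp: wreath_two_def K.m_assoc)
qed

text \<open>Makes the action well defined: exponents are stored reduced modulo m.\<close>

lemma power_mod_cong:
  fixes w :: int
  assumes "[w ^ m = 1] (mod n)"
  shows "[w ^ (k mod m) = w ^ k] (mod n)"
proof -
  have "[w ^ (k mod m) * (w ^ m) ^ (k div m) = w ^ (k mod m) * 1 ^ (k div m)] (mod n)"
    by (intro cong_mult cong_pow assms cong_refl)
  moreover have "w ^ (k mod m) * (w ^ m) ^ (k div m) = w ^ k"
    by (metis power_add power_mult mod_mult_div_eq)
  ultimately show ?thesis by (simp add: cong_sym)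
qed

lemma group_affine_group:
  assumes n: "n > 0" and m: "m > 0" and w: "[w ^ m = 1] (mod n)"
  shows "group (affine_group n w m)"
proof (rule groupI)
  fix x y z
  assume "x \<in> carrier (affine_group n w m)" "y \<in> carrier (affine_group n w m)"
    "z \<in> carrier (affine_group n w m)"
  then obtain a i b j c k where e: "x = (a, i)" "y = (b, j)" "z = (c, k)"
    by (metis surj_pair)
  have "[(a + w ^ i * b) mod n + w ^ ((i + j) mod m) * c = (a + w ^ i * b) + w ^ (i + j) * c] (mod n)"
    by (intro cong_add cong_mult power_mod_cong w) auto
  also have "(a + w ^ i * b) + w ^ (i + j) * c = a + w ^ i * (b + w ^ j * c)"
    by (simp add: algebra_simps power_add)
  also have "[\<dots> = a + w ^ i * ((b + w ^ j * c) mod n)] (mod n)"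
    by (intro cong_add cong_mult) auto
  finally show "x \<otimes>\<^bsub>affine_group n w m\<^esub> y \<otimes>\<^bsub>affine_group n w m\<^esub> z =
      x \<otimes>\<^bsub>affine_group n w m\<^esub> (y \<otimes>\<^bsub>affine_group n w m\<^esub> z)"
    by (simp add: affine_group_def e cong_def mod_simps add.assoc)
next
  fix x assume "x \<in> carrier (affine_group n w m)"
  then obtain a i where e: "x = (a, i)" "i < m" by (auto simp: affine_group_def)
  \<comment> \<open>The outer reduction matters for i = 0, since m itself lies outside the
    carrier.\<close>
  let ?j = "(m - i) mod m"
  let ?y = "((- (w ^ ?j * a)) mod n, ?j)"
  have "?y \<in> carrier (affine_group n w m)" using n m by (simp add: affine_group_def)
  moreover have "(?j + i) mod m = 0" using e by (simp add: mod_simps)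
  then have "?y \<otimes>\<^bsub>affine_group n w m\<^esub> x = \<one>\<^bsub>affine_group n w m\<^esub>"
    by (simp add: affine_group_def e mod_simps)
  ultimately show "\<exists>y\<in>carrier (affine_group n w m).
      y \<otimes>\<^bsub>affine_group n w m\<^esub> x = \<one>\<^bsub>affine_group n w m\<^esub>" by blast
qed (use n m in \<open>auto simp: affine_group_def\<close>)

section \<open>Roots of unity\<close>

text \<open>If n - 1 = d k, the k-th power of a primitive root has order d. Incongruent exponents
  then give a difference that the prime n does not divide. Stating this as coprimality also covers n
  = 1, where z = 1 serves.\<close>

lemma exists_root_of_unity:
  fixes n d :: nat
  assumes "n = 1 \<or> Factorial_Ring.prime n \<and> d dvd n - 1" and "d > 0"
  obtains z :: int where "[z ^ d = 1] (mod int n)"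
    "\<And>a b. a mod d \<noteq> b mod d \<Longrightarrow> coprime (z ^ a - z ^ b) (int n)"
proof (cases "n = 1")
  case True
  then show ?thesis using that[of 1] by simp
next
  case False
  with assms have p: "Factorial_Ring.prime n" and "d dvd n - 1" by auto
  then obtain k where k: "n - 1 = d * k" by blast
  obtain g where g: "residue_primroot n g" using prime_primitive_root_exists[OF _ p] prime_gt_1_nat[OF p] by blast
  have cop: "coprime n g" and "ord n g = n - 1"
    using g p by (auto simp: residue_primroot_def totient_prime)
  have k0: "k > 0" using k p by (cases "k = 0") (auto dest: prime_gt_1_nat)
  have ord: "ord n (g ^ k) = d"
    using ord_power_aux[of n g k] k k0 \<open>ord n g = n - 1\<close> by simp
  let ?z = "int (g ^ k)"
  have cop': "coprime n (g ^ k)" using cop by simp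
  show ?thesis
  proof (rule that[of ?z])
    have "[(g ^ k) ^ d = 1] (mod n)" using ord ord_works[of "g ^ k" n] by simp
    then show "[?z ^ d = 1] (mod int n)"
      using cong_int_iff[of "(g ^ k) ^ d" 1 n] by simp
    fix a b assume "a mod d \<noteq> b mod d"
    then have "\<not> [(g ^ k) ^ a = (g ^ k) ^ b] (mod n)"
      using order_divides_expdiff[OF cop'] ord by (simp add: cong_def)
    then have "\<not> [?z ^ a = ?z ^ b] (mod int n)"
      using cong_int_iff[of "(g ^ k) ^ a" "(g ^ k) ^ b" n] by simp
    then have "\<not> int n dvd ?z ^ a - ?z ^ b" by (simp add: cong_iff_dvd_diff)
    then have "coprime (int n) (?z ^ a - ?z ^ b)" using p by (intro prime_imp_coprime) auto
    then show "coprime (?z ^ a - ?z ^ b) (int n)" by (simp add: coprime_commute)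
  qed
qed

section \<open>Lines over the wreath product of two cyclic groups of order ten\<close>

text \<open>The matrix with rows (1, P) and (Q, R) has determinant R - P Q, a unit modulo n.
  Eliminating t gives u, and the first equation then gives t.\<close>

lemma linear_system_mod:
  fixes n P Q R x y :: int
  assumes n: "n > 0" and det: "coprime (R - P * Q) n" and xy: "x \<in> {0..<n}" "y \<in> {0..<n}"
  obtains t u where "t \<in> {0..<n}" "u \<in> {0..<n}"
    "(t + P * u) mod n = x" "(Q * t + R * u) mod n = y"
proof -
  obtain c where c: "[(R - P * Q) * c = 1] (mod n)" using cong_solve_coprime_int[OF det] by blast
  define u where "u = (c * (y - Q * x)) mod n"
  define t where "t = (x - P * u) mod n"
  have t: "[t = x - P * u] (mod n)" and u: "[u = c * (y - Q * x)] (mod n)"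
    by (simp_all add: t_def u_def)
  have "[t + P * u = (x - P * u) + P * u] (mod n)" by (intro cong_add t cong_refl)
  then have 1: "(t + P * u) mod n = x" using xy by (simp add: cong_def)
  have "[Q * t + R * u = Q * (x - P * u) + R * u] (mod n)"
    by (intro cong_add cong_mult t cong_refl)
  also have "Q * (x - P * u) + R * u = Q * x + (R - P * Q) * u" by (simp add: algebra_simps)
  also have "[\<dots> = Q * x + (R - P * Q) * (c * (y - Q * x))] (mod n)"
    by (intro cong_add cong_mult u cong_refl)
  also have "Q * x + (R - P * Q) * (c * (y - Q * x)) = Q * x + ((R - P * Q) * c) * (y - Q * x)"
    by (simp add: algebra_simps)
  also have "[\<dots> = Q * x + 1 * (y - Q * x)] (mod n)"
    by (intro cong_add cong_mult c cong_refl)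
  finally have 2: "(Q * t + R * u) mod n = y" using xy by (simp add: cong_def)
  show ?thesis using n by (intro that[OF _ _ 1 2]) (auto simp: t_def u_def)
qed

text \<open>
  A quadruple \<open>(i, j, e, a)\<close> stands for the element \<open>(i, j, e)\<close> of the base group together with the
  line \<open>{(t, z\<^sup>a t)}\<close>.
\<close>

fun base_mult :: "nat \<times> nat \<times> bool \<times> nat \<Rightarrow> nat \<times> nat \<times> bool \<times> nat \<Rightarrow> nat \<times> nat \<times> bool" where
  "base_mult (i, j, e, a) (k, l, f, b) =
     ((i + (if e then l else k)) mod 10, (j + (if e then k else l)) mod 10, e \<noteq> f)"

text \<open>
  The translate of the second line has direction \<open>(z\<^sup>p, z\<^sup>r)\<close>, where \<open>p\<close> is the summand
  before \<open>a\<close> on the right and \<open>r\<close> the left-hand side below; the determinant of the two directions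
  is \<open>z\<^sup>r - z\<^sup>p\<^sup>+\<^sup>a\<close>.
\<close>

fun transversal :: "nat \<times> nat \<times> bool \<times> nat \<Rightarrow> nat \<times> nat \<times> bool \<times> nat \<Rightarrow> bool" where
  "transversal (i, j, e, a) (k, l, f, b) \<longleftrightarrow>
     (2 * j + (if e then 0 else b)) mod 10 \<noteq> (2 * i + (if e then b else 0) + a) mod 10"

text \<open>Found by simulated annealing over inverse-closed systems of lines.\<close>

definition lines :: "(nat \<times> nat \<times> bool \<times> nat) list" where
  "lines =
    [(1, 4, False, 2), (2, 3, False, 6), (5, 0, False, 2), (8, 7, False, 4), (9, 6, False, 6),
     (0, 0, True, 0), (0, 0, True, 5), (0, 5, True, 3), (0, 9, True, 7), (1, 0, True, 1),
     (1, 3, True, 5), (2, 5, True, 1), (5, 0, True, 7), (5, 8, True, 5), (7, 1, True, 8),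
     (7, 9, True, 9), (9, 3, True, 0)]"

text \<open>A finite check that does not involve n: the transversal ones among 17 * 17 pairs must
  reach all 200 base elements. The list form allows evaluation.\<close>

lemma base_products_cover:
  "set (List.product [0..<10] (List.product [0..<10] [False, True]))
     \<subseteq> set (map (\<lambda>(l, m). base_mult l m)
          (filter (\<lambda>(l, m). transversal l m) (List.product lines lines)))"
  by code_simp

lemma lines_cover:
  assumes "i < 10" "j < 10"
  obtains l m where "l \<in> set lines" "m \<in> set lines" "transversal l m" "base_mult l m = (i, j, e)"
proof -
  have "(i, j, e) \<in> set (List.product [0..<10] (List.product [0..<10] [False, True]))"
    using assms by auto
  then have "(i, j, e) \<in> (\<lambda>(l, m). base_mult l m) `
      set (filter (\<lambda>(l, m). transversal l m) (List.product lines lines))"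
    using subsetD[OF base_products_cover] unfolding set_map by blast
  then obtain l m where "(l, m) \<in> set (filter (\<lambda>(l, m). transversal l m) (List.product lines lines))"
    "(i, j, e) = base_mult l m"
    by (elim imageE) (metis (no_types, lifting) case_prod_conv surj_pair)
  then have "l \<in> set lines" "m \<in> set lines" "transversal l m" "base_mult l m = (i, j, e)"
    unfolding set_filter set_product by simp_all
  then show ?thesis by (rule that)
qed

text \<open>Failure of transversality is what is wanted here: the translate of the second line is
  parallel to the first, so each point of the first can be cancelled by a point of the
  second.\<close>

lemma lines_inverse: "\<forall>l\<in>set lines. \<exists>m\<in>set lines. \<not> transversal l m \<and> base_mult l m = (0, 0, False)"
  by code_simp

lemma lines_bounds: "\<forall>(i, j, e, a)\<in>set lines. i < 10 \<and> j < 10 \<and> (i, j, e) \<noteq> (0, 0, False)"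
  by code_simp

text \<open>Needed for counting: the only base element carrying two lines is the swap, with slope
  exponents 0 and 5.\<close>

lemma lines_double:
  "\<forall>(i, j, e, a)\<in>set lines. \<forall>(k, l, f, b)\<in>set lines. (i, j, e) = (k, l, f) \<longrightarrow>
     a = b \<or> a mod 10 \<noteq> b mod 10 \<and> (i, j, e) = (0, 0, True) \<and> (a = 5 \<or> b = 5)"
  by code_simp

lemma card_lines: "card (set lines) = 17"
  by code_simp

section \<open>The group of order 200 n^2 and its connection set\<close>

locale tenth_root_of_unity =
  fixes n z :: int
  assumes n_pos: "n > 0"
    and z_pow: "[z ^ 10 = 1] (mod n)"
    and z_diff: "a mod 10 \<noteq> b mod 10 \<Longrightarrow> coprime (z ^ a - z ^ b) n"
begin

definition K :: "(int \<times> nat) monoid" where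
  "K = affine_group n (z ^ 2) 10"

definition W :: "((int \<times> nat) \<times> (int \<times> nat) \<times> bool) monoid" where
  "W = wreath_two K"

fun lift :: "nat \<times> nat \<times> bool \<times> nat \<Rightarrow> int \<Rightarrow> (int \<times> nat) \<times> (int \<times> nat) \<times> bool" where
  "lift (i, j, e, a) t = ((t, i), ((z ^ a * t) mod n, j), e)"

definition S :: "((int \<times> nat) \<times> (int \<times> nat) \<times> bool) set" where
  "S = (\<Union>l\<in>set lines. lift l ` {0..<n})"

lemma group_W: "group W"
proof -
  have "[(z ^ 10) ^ 2 = 1 ^ 2] (mod n)" by (intro cong_pow z_pow)
  then have "[(z ^ 2) ^ 10 = 1] (mod n)" by (simp add: power_mult[symmetric])
  then show ?thesis
    unfolding W_def K_def by (intro group_wreath_two group_affine_group n_pos) auto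
qed

lemma carrier_W: "carrier W = ({0..<n} \<times> {0..<10}) \<times> ({0..<n} \<times> {0..<10}) \<times> UNIV"
  by (simp add: W_def K_def wreath_two_def affine_group_def)

lemma one_W: "\<one>\<^bsub>W\<^esub> = ((0, 0), (0, 0), False)"
  by (simp add: W_def K_def wreath_two_def affine_group_def)

lemma card_W: "card (carrier W) = 200 * nat n ^ 2"
  by (simp add: carrier_W card_cartesian_product power2_eq_square)

lemma z_pow_cong: "a mod 10 = b mod 10 \<Longrightarrow> [z ^ a = z ^ b] (mod n)"
  using power_mod_cong[OF z_pow, of a] power_mod_cong[OF z_pow, of b]
  by (metis cong_sym cong_trans)

text \<open>The plane part of a product is linear in the parameters (t, u), with matrix rows (1,
  z^p) and (z^q, z^r). The exponents are hidden behind an existential so that later arguments need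
  no case split on the swap.\<close>

lemma lift_mult:
  "\<exists>p q r. (\<forall>t u. lift l t \<otimes>\<^bsub>W\<^esub> lift m u =
      (case base_mult l m of (i, j, e) \<Rightarrow>
        (((t + z ^ p * u) mod n, i), ((z ^ q * t + z ^ r * u) mod n, j), e))) \<and>
    (transversal l m \<longleftrightarrow> r mod 10 \<noteq> (p + q) mod 10)"
proof -
  obtain i j e a where l: "l = (i, j, e, a)" by (metis surj_pair)
  obtain k l' f b where m: "m = (k, l', f, b)" by (metis surj_pair)
  \<comment> \<open>The second line has direction (1, z^b). The swap \<open>e\<close> exchanges
    these components, and i and j then scale them by z^(2i) and z^(2j).\<close>
  let ?p = "2 * i + (if e then b else 0)" and ?r = "2 * j + (if e then 0 else b)"
  have "lift l t \<otimes>\<^bsub>W\<^esub> lift m u =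
      (case base_mult l m of (i, j, e) \<Rightarrow>
        (((t + z ^ ?p * u) mod n, i), ((z ^ a * t + z ^ ?r * u) mod n, j), e))" for t u
  proof (cases e)
    case True
    have "(t + (z ^ 2) ^ i * (z ^ b * u mod n)) mod n = (t + (z ^ 2) ^ i * (z ^ b * u)) mod n"
      by (metis mod_add_right_eq mod_mult_right_eq)
    then show ?thesis using True
      by (simp add: l m W_def K_def wreath_two_def affine_group_def power_add power_mult mod_simps mult.assoc)
  next
    case False
    have "(z ^ a * t mod n + (z ^ 2) ^ j * (z ^ b * u mod n)) mod n =
        (z ^ a * t + (z ^ 2) ^ j * (z ^ b * u)) mod n"
      by (metis mod_add_eq mod_add_right_eq mod_mult_right_eq)
    then show ?thesis using False
      by (simp add: l m W_def K_def wreath_two_def affine_group_def power_add power_mult mod_simps mult.assoc)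
  qed
  moreover have "transversal l m \<longleftrightarrow> ?r mod 10 \<noteq> (?p + a) mod 10" by (simp add: l m)
  ultimately show ?thesis by blast
qed

lemma S_products:
  assumes "g \<in> carrier W"
  shows "\<exists>s\<in>S. \<exists>t\<in>S. g = s \<otimes>\<^bsub>W\<^esub> t"
proof -
  obtain x i y j e where g: "g = ((x, i), (y, j), e)"
    and xy: "x \<in> {0..<n}" "y \<in> {0..<n}" and ij: "i < 10" "j < 10"
    using assms by (auto simp: carrier_W)
  obtain l m where lm: "l \<in> set lines" "m \<in> set lines" "transversal l m" "base_mult l m = (i, j, e)"
    using lines_cover[OF ij] .
  obtain p q r where prod: "\<And>t u. lift l t \<otimes>\<^bsub>W\<^esub> lift m u =
      (((t + z ^ p * u) mod n, i), ((z ^ q * t + z ^ r * u) mod n, j), e)"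
    and tr: "r mod 10 \<noteq> (p + q) mod 10"
    using lift_mult[of l m] lm(3,4) by auto
  have "coprime (z ^ r - z ^ p * z ^ q) n" using z_diff[OF tr] by (simp add: power_add)
  then obtain t u where "t \<in> {0..<n}" "u \<in> {0..<n}"
      "(t + z ^ p * u) mod n = x" "(z ^ q * t + z ^ r * u) mod n = y"
    using linear_system_mod[OF n_pos _ xy] by blast
  then have "lift l t \<in> S" "lift m u \<in> S" "g = lift l t \<otimes>\<^bsub>W\<^esub> lift m u"
    using lm unfolding S_def by (blast, blast, simp add: prod g)
  then show ?thesis by blast
qed

lemma S_inverse:
  assumes "s \<in> S"
  shows "\<exists>s'\<in>S. s \<otimes>\<^bsub>W\<^esub> s' = \<one>\<^bsub>W\<^esub>"
proof -
  obtain l t where l: "l \<in> set lines" "t \<in> {0..<n}" "s = lift l t" using assms by (auto simp: S_def)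
  obtain m where m: "m \<in> set lines" "\<not> transversal l m" "base_mult l m = (0, 0, False)"
    using lines_inverse l(1) by blast
  obtain p q r where prod: "\<And>t u. lift l t \<otimes>\<^bsub>W\<^esub> lift m u =
      (((t + z ^ p * u) mod n, 0), ((z ^ q * t + z ^ r * u) mod n, 0), False)"
    and tr: "r mod 10 = (p + q) mod 10"
    using lift_mult[of l m] m(2,3) by auto
  \<comment> \<open>Solves t + z^p u = 0: since z^10 = 1 modulo n, z^(9p) is the inverse of
    z^p.\<close>
  define u where "u = (- (z ^ (9 * p) * t)) mod n"
  have u: "[u = - (z ^ (9 * p) * t)] (mod n)" by (simp add: u_def)
  have "[t + z ^ p * u = z ^ 0 * t + z ^ p * (- (z ^ (9 * p) * t))] (mod n)"
    by (intro cong_add cong_mult u) auto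
  also have "z ^ 0 * t + z ^ p * (- (z ^ (9 * p) * t)) = (z ^ 0 - z ^ (10 * p)) * t"
    by (simp add: algebra_simps power_add[symmetric])
  also have "[\<dots> = (z ^ 0 - z ^ 0) * t] (mod n)"
    by (intro cong_mult cong_diff z_pow_cong) auto
  finally have 1: "(t + z ^ p * u) mod n = 0" by (simp add: cong_def)
  \<comment> \<open>As r and p + q agree modulo 10, the second coordinate is z^q times the first and
    vanishes with it.\<close>
  have "[z ^ q * t + z ^ r * u = z ^ q * t + z ^ (p + q) * u] (mod n)"
    by (intro cong_add cong_mult z_pow_cong tr) auto
  also have "z ^ q * t + z ^ (p + q) * u = z ^ q * (t + z ^ p * u)" by (simp add: algebra_simps power_add)
  finally have 2: "(z ^ q * t + z ^ r * u) mod n = 0"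
    using 1 by (metis cong_def mod_mult_right_eq mult_zero_right mod_0)
  have "u \<in> {0..<n}" using n_pos by (simp add: u_def)
  then have "lift m u \<in> S" using m(1) unfolding S_def by blast
  moreover have "s \<otimes>\<^bsub>W\<^esub> lift m u = \<one>\<^bsub>W\<^esub>" by (simp add: l prod 1 2 one_W)
  ultimately show ?thesis by blast
qed

lemma S_subset: "S \<subseteq> carrier W"
proof
  fix s assume "s \<in> S"
  then obtain i j e a t where "(i, j, e, a) \<in> set lines" "t \<in> {0..<n}" "s = lift (i, j, e, a) t"
    by (auto simp: S_def simp del: lift.simps)
  then show "s \<in> carrier W" using bspec[OF lines_bounds] n_pos by (fastforce simp: carrier_W)
qed

lemma one_notin_S: "\<one>\<^bsub>W\<^esub> \<notin> S"
proof
  assume "\<one>\<^bsub>W\<^esub> \<in> S"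
  then obtain i j e a t where "(i, j, e, a) \<in> set lines" "\<one>\<^bsub>W\<^esub> = lift (i, j, e, a) t"
    by (auto simp: S_def simp del: lift.simps)
  then show False using bspec[OF lines_bounds] by (fastforce simp: one_W)
qed

lemma card_S: "card S = 17 * nat n - 1"
proof -
  \<comment> \<open>The two lines over the swap share their origin; removing one of its two
    parameters leaves 17 n - 1, on which \<open>lift\<close> is injective.\<close>
  define D where "D = set lines \<times> {0..<n} - {((0, 0, True, 5), 0)}"
  have mem: "(0, 0, True, 0) \<in> set lines" "(0, 0, True, 5) \<in> set lines"
    by (simp_all add: lines_def)
  have "S = case_prod lift ` (set lines \<times> {0..<n})"
    unfolding S_def by (simp add: Sigma_def image_UN image_image UNION_singleton_eq_range)
  also have "\<dots> = case_prod lift ` D"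
  proof -
    have common: "case_prod lift ((0, 0, True, 5), 0) = case_prod lift ((0, 0, True, 0), 0)" by simp
    have D0: "((0, 0, True, 0), 0) \<in> D" using mem n_pos by (simp add: D_def)
    have split: "set lines \<times> {0..<n} = insert ((0, 0, True, 5), 0) D"
      using mem n_pos by (auto simp: D_def)
    show ?thesis unfolding split image_insert common by (rule insert_absorb[OF imageI[OF D0]])
  qed
  also have "card \<dots> = card D"
  proof (rule card_image, rule inj_onI)
    fix v w assume D: "v \<in> D" "w \<in> D" and eq: "case_prod lift v = case_prod lift w"
    obtain i j e a t where v: "v = ((i, j, e, a), t)" by (metis surj_pair)
    obtain b where w: "w = ((i, j, e, b), t)" using eq by (cases w) (auto simp: v)
    have mems: "(i, j, e, a) \<in> set lines" "(i, j, e, b) \<in> set lines" "t \<in> {0..<n}"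
      using D by (auto simp: D_def v w)
    \<comment> \<open>For different slopes over one base element, z^a - z^b is a unit, so a common
      point has t = 0. \<open>D\<close> keeps that point only for slope exponent 0.\<close>
    have "a = b"
    proof (rule ccontr)
      assume "a \<noteq> b"
      then have ab: "a mod 10 \<noteq> b mod 10" "(i, j, e) = (0, 0, True)" "a = 5 \<or> b = 5"
        using bspec[OF bspec[OF lines_double mems(1), simplified] mems(2)] by auto
      have "[z ^ a * t = z ^ b * t] (mod n)" using eq by (simp add: v w cong_def)
      then have "n dvd (z ^ a - z ^ b) * t" by (simp add: cong_iff_dvd_diff algebra_simps)
      then have "n dvd t" using z_diff[OF ab(1)] by (simp add: coprime_commute coprime_dvd_mult_right_iff)
      then have "t = 0" using mems(3) zdvd_not_zless[of t n] by fastforce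
      then show False using ab D by (auto simp: D_def v w)
    qed
    then show "v = w" by (simp add: v w)
  qed
  also have "\<dots> = 17 * nat n - 1"
    using mem n_pos by (simp add: D_def card_Diff_subset card_cartesian_product card_lines)
  finally show ?thesis .
qed

end

theorem theorem1:
  fixes n :: nat
  assumes "n = 1 \<or> (Factorial_Ring.prime n \<and> n mod 10 = 1)"
  shows "\<exists>(G :: nat monoid) S. group G \<and> finite (carrier G) \<and> cayley_set G S \<and>
           connected_graph (carrier G) (cayley_adj G S) \<and>
           graph_diameter (carrier G) (cayley_adj G S) = 2 \<and>
           card S = 17 * n - 1 \<and>
           card (carrier G) = 200 * n ^ 2"
proof -
  have n: "n > 0" using assms by (cases "n = 0") auto
  have "n = 1 \<or> Factorial_Ring.prime n \<and> 10 dvd n - 1"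
    using assms by (metis dvd_minus_mod)
  then obtain z :: int where z: "[z ^ 10 = 1] (mod int n)"
    "\<And>a b. a mod 10 \<noteq> b mod 10 \<Longrightarrow> coprime (z ^ a - z ^ b) (int n)"
    using exists_root_of_unity[of n 10] by auto
  interpret tenth_root_of_unity "int n" z by unfold_locales (use n z in auto)
  \<comment> \<open>The statement asks for a group on natural numbers, so the group and its
    connection set are carried over along an injective encoding.\<close>
  let ?f = "to_nat :: (int \<times> nat) \<times> (int \<times> nat) \<times> bool \<Rightarrow> nat"
  let ?G = "image_group ?f W"
  let ?S = "?f ` S"
  interpret W: group W by (rule group_W)
  have inj: "inj_on ?f A" for A by (rule inj_on_subset[OF inj_to_nat]) simp
  interpret G: group ?G by (rule W.inj_imp_image_group_is_group[OF inj])
  have carrier: "carrier ?G = ?f ` carrier W" and one: "\<one>\<^bsub>?G\<^esub> = ?f \<one>\<^bsub>W\<^esub>"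
    by (simp_all add: image_group_def)
  have mult: "?f a \<otimes>\<^bsub>?G\<^esub> ?f b = ?f (a \<otimes>\<^bsub>W\<^esub> b)" if "a \<in> carrier W" "b \<in> carrier W" for a b
    using that inj by (simp add: image_group_def)
  have mult_S: "?f a \<otimes>\<^bsub>?G\<^esub> ?f b = ?f (a \<otimes>\<^bsub>W\<^esub> b)" if "a \<in> S" "b \<in> S" for a b
    using that S_subset by (intro mult) auto
  have fin: "finite (carrier ?G)" by (simp add: carrier carrier_W)
  have card_G: "card (carrier ?G) = 200 * n ^ 2"
    using card_W by (simp add: carrier card_image[OF inj])
  have card_S': "card ?S = 17 * n - 1" using card_S by (simp add: card_image[OF inj])
  have inverses: "\<exists>y\<in>?S. x \<otimes>\<^bsub>?G\<^esub> y = \<one>\<^bsub>?G\<^esub>" if x: "x \<in> ?S" for x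
  proof -
    obtain s where s: "s \<in> S" "x = ?f s" using x by blast
    obtain s' where "s' \<in> S" "s \<otimes>\<^bsub>W\<^esub> s' = \<one>\<^bsub>W\<^esub>" using S_inverse[OF s(1)] by blast
    then show ?thesis using s mult_S one by auto
  qed
  have products: "\<exists>s\<in>?S. \<exists>t\<in>?S. g = s \<otimes>\<^bsub>?G\<^esub> t" if g: "g \<in> carrier ?G" for g
  proof -
    obtain h where h: "h \<in> carrier W" "g = ?f h" using g by (auto simp: carrier)
    obtain s t where "s \<in> S" "t \<in> S" "h = s \<otimes>\<^bsub>W\<^esub> t" using S_products[OF h(1)] by blast
    then show ?thesis using h mult_S by auto
  qed
  \<comment> \<open>The left side is the number of connection elements plus one for the
    identity.\<close>
  have "17 * n < 200 * n ^ 2" using n by (simp add: power2_eq_square)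
  then have card: "card ?S + 1 < card (carrier ?G)" using n by (simp add: card_G card_S')
  have sub: "?S \<subseteq> carrier ?G" using S_subset by (auto simp: carrier)
  have one_notin: "\<one>\<^bsub>?G\<^esub> \<notin> ?S" using one_notin_S by (auto simp: one inj_image_mem_iff)
  note diameter = G.cayley_diameter_two[OF fin sub one_notin inverses products card]
  show ?thesis using G.group_axioms fin diameter card_G card_S' by blast
qed

end
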